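(* Let $a,b,p,q$ be positive real numbers. Then for every $x\in(0,1)$, $$x \le \Phi_{p,q}(a,b;x) \le (1+a)^p(1+b)^q\,\frac{x}{1-x}.$$
   Context: The generalized polylogarithm is $$\Phi_{p,q}(a,b;x) = \sum_{k=1}^\infty \frac{(1+a)^p(1+b)^q}{(k+a)^p(k+b)^q} x^k, \qquad |x|<1.$$ *)

theory Defs
  imports "HOL-Analysis.Analysis"
begin

text \<open>
  The summation index is shifted: the summand at \<open>k\<close> is the term of index \<open>k + 1\<close> of the
  usual series, which starts at 1.  The definition is intended for \<open>a, b > -1\<close>, where all bases of
  the real powers are positive, and for \<open>\<bar>x\<bar> < 1\<close>.
\<close>

definition gen_polylog :: "real \<Rightarrow> real \<Rightarrow> real \<Rightarrow> real \<Rightarrow> real \<Rightarrow> real" where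
  "gen_polylog p q a b x =
     (\<Sum>k. ((1 + a) powr p * (1 + b) powr q) /
          ((real (Suc k) + a) powr p * (real (Suc k) + b) powr q) * x ^ Suc k)"

text \<open>
  For the parameters considered here the series converges, so \<^const>\<open>suminf\<close> is its true sum.
\<close>

lemma gen_polylog_summable:
  fixes a b p q x :: real
  assumes "a > -1" "b > -1" "p \<ge> 0" "q \<ge> 0" "\<bar>x\<bar> < 1"
  shows "summable (\<lambda>k. ((1 + a) powr p * (1 + b) powr q) /
          ((real (Suc k) + a) powr p * (real (Suc k) + b) powr q) * x ^ Suc k)"
proof (rule summable_comparison_test')
  show "summable (\<lambda>k. \<bar>x\<bar> ^ k)"
    using assms by (intro summable_geometric) simp
next
  fix k :: nat
  define c where "c = ((1 + a) powr p * (1 + b) powr q) /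
          ((real (Suc k) + a) powr p * (real (Suc k) + b) powr q)"
  have "(1 + a) powr p * (1 + b) powr q \<le> (real (Suc k) + a) powr p * (real (Suc k) + b) powr q"
    using assms by (intro mult_mono powr_mono2) auto
  moreover have "(real (Suc k) + a) powr p * (real (Suc k) + b) powr q > 0"
    using assms by auto
  ultimately have c: "0 \<le> c" "c \<le> 1"
    unfolding c_def by (simp_all add: divide_le_eq_1)
  have "norm (c * x ^ Suc k) = c * \<bar>x\<bar> ^ Suc k"
    using c by (simp add: abs_mult power_abs)
  also have "\<dots> \<le> 1 * \<bar>x\<bar> ^ k"
    using c assms by (intro mult_mono power_decreasing) auto
  finally show "norm (((1 + a) powr p * (1 + b) powr q) /
          ((real (Suc k) + a) powr p * (real (Suc k) + b) powr q) * x ^ Suc k) \<le> \<bar>x\<bar> ^ k"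
    unfolding c_def by simp
qed

end

theory Submission
  imports Defs
begin

text \<open>Every summand \<open>C / d k * x ^ Suc k\<close> is nonnegative, and the normalising
  factor \<open>C\<close> makes the first one exactly \<open>x\<close>, so the sum is at least
  \<open>x\<close>. For the upper bound, all bases exceed 1 and the exponents are positive, so
  \<open>d k\<close> is at least 1; the series is then dominated termwise by \<open>C\<close> times
  the geometric series x + x^2 + ... = x / (1 - x).\<close>

theorem corollary3p4:
  fixes a b p q x :: real
  assumes "a > 0" and "b > 0" and "p > 0" and "q > 0"
    and "x \<in> {0<..<1}"
  shows "x \<le> gen_polylog p q a b x
    \<and> gen_polylog p q a b x \<le> (1 + a) powr p * (1 + b) powr q * (x / (1 - x))"
proof
  define C where "C = (1 + a) powr p * (1 + b) powr q"
  define d where "d k = (real (Suc k) + a) powr p * (real (Suc k) + b) powr q" for k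
  have x: "0 < x" "x < 1"
    using assms(5) by auto
  have C: "C > 0"
    unfolding C_def using assms by simp
  have d: "d k \<ge> 1" for k
  proof -
    \<comment> \<open>The form \<open>1 * 1\<close> lets \<open>mult_mono\<close> compare the two
      powers separately.\<close>
    have "1 * 1 \<le> d k"
      unfolding d_def using assms by (intro mult_mono ge_one_powr_ge_zero) auto
    then show ?thesis
      by simp
  qed
  have summ: "summable (\<lambda>k. C / d k * x ^ Suc k)"
    unfolding C_def d_def using assms x by (intro gen_polylog_summable) auto
  have eq: "gen_polylog p q a b x = (\<Sum>k. C / d k * x ^ Suc k)"
    unfolding gen_polylog_def C_def d_def ..
  have nonneg: "0 \<le> C / d k * x ^ Suc k" for k
    using C d[of k] x by simp
  have "d 0 = C"
    by (simp add: C_def d_def)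
  \<comment> \<open>The leading term is written as a partial sum over \<open>{0}\<close>, to be
    compared with the whole series by \<open>sum_le_suminf\<close>.\<close>
  then have "x = (\<Sum>k\<in>{0}. C / d k * x ^ Suc k)"
    using C by simp
  also have "\<dots> \<le> gen_polylog p q a b x"
    unfolding eq by (intro sum_le_suminf summ nonneg) auto
  finally show "x \<le> gen_polylog p q a b x" .
  \<comment> \<open>\<open>geometric_sums\<close> starts at exponent 0, whereas the series here
    starts at exponent 1; the extra factor \<open>x\<close> makes up the difference.\<close>
  have "(\<lambda>k. C * x * x ^ k) sums (C * x * (1 / (1 - x)))"
    using x by (intro sums_mult geometric_sums) simp
  then have geo: "(\<lambda>k. C * x ^ Suc k) sums (C * (x / (1 - x)))"
    by (simp add: mult_ac)
  have "C / d k * x ^ Suc k \<le> C * x ^ Suc k" for k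
  proof -
    have "C / d k \<le> C / 1"
      using C d[of k] by (intro divide_left_mono) auto
    then show ?thesis
      using x by (intro mult_right_mono) auto
  qed
  then have "gen_polylog p q a b x \<le> C * (x / (1 - x))"
    unfolding eq by (rule sums_le[OF _ summable_sums[OF summ] geo])
  then show "gen_polylog p q a b x \<le> (1 + a) powr p * (1 + b) powr q * (x / (1 - x))"
    unfolding C_def .
qed

end
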